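(* Let $q$ be an odd prime power, $d\ge 3$, $E\subset \mathbb F_q^d$ nonempty, $\lambda=0$, and $0<N<q$ a real number. For $\mathbf{x}\in \mathbb{F}_q^{d-1}$, define $f(\mathbf{x}) := \#\{t \in \mathbb{F}_q : (\mathbf{x},t) \in E\}$. Then $$|\mathcal{T}_1(X_\pi, E, N)| \le \frac{2q^{d-1}N}{(q-N)|E|} \cdot \max_{\mathbf x\in \mathbb{F}_q^{d-1}}f(\mathbf x).$$
   Context: $\mathbb F_q$ is the finite field with $q$ elements. For $\mathbf x\in\mathbb F_q^d$, $\|\mathbf x\|=x_1^2+\cdots+x_d^2$, and $\mathbf x\cdot\mathbf y=\sum_i x_iy_i$. $S^{d-1}=\{\mathbf x\in\mathbb F_q^d:\|\mathbf x\|=1\}$, $\pi=\{\mathbf x\in\mathbb F_q^d: x_d=\lambda\}$ (here $\lambda=0$). $X_\pi$ is the set of lines through the origin (one-dimensional linear subspaces of $\mathbb F_q^d$) that contain a nonzero element of $\pi\cap S^{d-1}$. For a linear subspace $V$, $V^\perp=\{\mathbf x\in\mathbb F_q^d:\mathbf x\cdot\mathbf y=0\ \forall \mathbf y\in V\}$, and $\pi_V(E)=\{\mathbf x+V^\perp:\mathbf x\in\mathbb F_q^d,\ (\mathbf x+V^\perp)\cap E\neq\emptyset\}$, a set of cosets. $\mathcal T_1(X_\pi,E,N)=\{V\in X_\pi: |\pi_V(E)|\le N\}$. *)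

theory Defs
  imports "Jordan_Normal_Form.VS_Connect" "HOL-Library.Cardinality"
begin

text \<open>
  The finite field is a type \<open>'a :: {field, finite}\<close> with \<open>q = CARD('a)\<close>, and its \<open>d\<close>-dimensional
  coordinate space is \<open>carrier_vec d\<close>.  Coordinates are indexed from \<open>0\<close>, so the last coordinate
  of \<open>x\<close> is \<open>x $ (d - 1)\<close>.
\<close>

definition quad_norm :: "'a :: comm_ring_1 vec \<Rightarrow> 'a" where
  "quad_norm x = (\<Sum>i<dim_vec x. (x $ i)\<^sup>2)"

definition unit_sphere :: "nat \<Rightarrow> 'a :: comm_ring_1 vec set" where
  "unit_sphere d = {x \<in> carrier_vec d. quad_norm x = 1}"

definition hyperplane :: "nat \<Rightarrow> 'a \<Rightarrow> 'a vec set" where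
  "hyperplane d l = {x \<in> carrier_vec d. x $ (d - 1) = l}"

definition lines :: "nat \<Rightarrow> 'a :: field vec set set" where
  "lines d = {V. subspace class_ring V (module_vec TYPE('a) d) \<and>
     vectorspace.dim class_ring ((module_vec TYPE('a) d)\<lparr>carrier := V\<rparr>) = 1}"

definition lines_meeting :: "nat \<Rightarrow> 'a :: field vec set \<Rightarrow> 'a vec set set" where
  "lines_meeting d P = {V \<in> lines d. \<exists>x \<in> V. x \<noteq> 0\<^sub>v d \<and> x \<in> P \<inter> unit_sphere d}"

definition orth_compl :: "nat \<Rightarrow> 'a :: comm_ring_1 vec set \<Rightarrow> 'a vec set" where
  "orth_compl d V = {x \<in> carrier_vec d. \<forall>y \<in> V. x \<bullet> y = 0}"

text \<open>The projection of \<open>E\<close> to \<open>V\<close> is a set of cosets of the orthogonal complement, since over a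
  finite field \<open>V\<close> and its complement need not be in direct sum.\<close>

definition coset_proj :: "nat \<Rightarrow> 'a :: comm_ring_1 vec set \<Rightarrow> 'a vec set \<Rightarrow> 'a vec set set" where
  "coset_proj d V E = {C. \<exists>x \<in> carrier_vec d. C = (\<lambda>y. x + y) ` orth_compl d V \<and> C \<inter> E \<noteq> {}}"

definition exceptional ::
  "nat \<Rightarrow> 'a :: comm_ring_1 vec set set \<Rightarrow> 'a vec set \<Rightarrow> real \<Rightarrow> 'a vec set set" where
  "exceptional d X E N = {V \<in> X. real (card (coset_proj d V E)) \<le> N}"

definition fibre_count :: "'a vec set \<Rightarrow> 'a vec \<Rightarrow> nat" where
  "fibre_count E x = card {t. x @\<^sub>v vec_of_list [t] \<in> E}"

text \<open>All sets whose cardinality or maximum is taken are finite, so \<open>card\<close> and \<open>Max\<close> have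
  their intended meaning.\<close>

lemma finite_carrier_vec: "finite (carrier_vec n :: 'a :: finite vec set)"
proof (rule finite_subset)
  show "carrier_vec n \<subseteq> vec_of_list ` {xs :: 'a list. set xs \<subseteq> UNIV \<and> length xs = n}"
  proof
    fix v :: "'a vec" assume "v \<in> carrier_vec n"
    then have "v = vec_of_list (list_of_vec v)" "length (list_of_vec v) = n"
      by (auto simp: vec_list)
    then show "v \<in> vec_of_list ` {xs. set xs \<subseteq> UNIV \<and> length xs = n}" by blast
  qed
qed (intro finite_imageI finite_lists_length_eq finite)

lemma finite_lines: "finite (lines d :: 'a :: {field, finite} vec set set)"
proof (rule finite_subset)
  show "lines d \<subseteq> Pow (carrier_vec d :: 'a vec set)"
    by (auto simp: lines_def subspace_def submodule_def module_vec_simps)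
qed (simp add: finite_carrier_vec)

lemma finite_coset_proj: "finite (coset_proj d V (E :: 'a :: {field, finite} vec set))"
proof (rule finite_subset)
  show "coset_proj d V E \<subseteq> (\<lambda>x. (\<lambda>y. x + y) ` orth_compl d V) ` carrier_vec d"
    by (auto simp: coset_proj_def)
qed (simp add: finite_carrier_vec)

end

theory Submission
  imports Defs "Berlekamp_Zassenhaus.Berlekamp_Type_Based" "HOL-Analysis.Convex"
begin

unbundle no inner_syntax

text \<open>
  For a direction \<open>\<theta>\<close> in the hyperplane, the number of pairs in \<open>E \<times> E\<close> with equal inner product
  with \<open>\<theta>\<close> is at least \<open>|E|\<^sup>2 / q\<close>, and at least \<open>|E|\<^sup>2 / N\<close> when \<open>\<theta>\<close> spans an exceptional line, both
  by Cauchy-Schwarz. Summing over all \<open>\<theta>\<close> in the hyperplane and swapping the order of summation, a pair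
  with distinct projections to the first \<open>d - 1\<close> coordinates is counted \<open>q ^ (d - 2)\<close> times, so that
  the total excess over \<open>|E|\<^sup>2 / q\<close> comes only from the pairs with equal projections, of which there
  are at most \<open>|E| max f\<close>. Each exceptional line contributes its \<open>q - 1\<close> nonzero vectors to the
  excess.
\<close>

section \<open>Colliding pairs of a map, and double counting\<close>

text \<open>Cauchy-Schwarz on the fibre sizes of \<open>g\<close>: their sum is
  \<open>card A\<close>, and the sum of their squares is the number of colliding pairs.\<close>

lemma card_square_le_card_image_times_collisions:
  assumes "finite A"
  shows "(real (card A))\<^sup>2 \<le> real (card (g ` A)) * real (card {p \<in> A \<times> A. g (fst p) = g (snd p)})"
proof -
  define F where "F c = {x \<in> A. g x = c}" for c
  have finF: "finite (F c)" for c
    using assms by (simp add: F_def)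
  have "A = (\<Union>c\<in>g ` A. F c)"
    by (auto simp: F_def)
  moreover have "card (\<Union>c\<in>g ` A. F c) = (\<Sum>c\<in>g ` A. card (F c))"
    by (rule card_UN_disjoint) (use assms finF in \<open>auto simp: F_def\<close>)
  ultimately have A: "card A = (\<Sum>c\<in>g ` A. card (F c))"
    by simp
  have "{p \<in> A \<times> A. g (fst p) = g (snd p)} = (\<Union>c\<in>g ` A. F c \<times> F c)"
    by (auto simp: F_def)
  moreover have "card (\<Union>c\<in>g ` A. F c \<times> F c) = (\<Sum>c\<in>g ` A. card (F c \<times> F c))"
    by (rule card_UN_disjoint) (use assms finF in \<open>auto simp: F_def\<close>)
  ultimately have pairs: "card {p \<in> A \<times> A. g (fst p) = g (snd p)} = (\<Sum>c\<in>g ` A. (card (F c))\<^sup>2)"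
    by (simp add: card_cartesian_product power2_eq_square)
  show ?thesis
    using sum_squared_le_sum_of_squares[of "\<lambda>c. real (card (F c))" "g ` A"]
    unfolding pairs A by (simp add: mult.commute)
qed

lemma sum_card_filter_swap:
  assumes "finite A" "finite B"
  shows "(\<Sum>a\<in>A. card {b \<in> B. P a b}) = (\<Sum>b\<in>B. card {a \<in> A. P a b})"
  by (rule sum_multicount_gen) (use assms in auto)

section \<open>Counting vectors in the hyperplane\<close>

lemma card_hyperplane:
  "card (hyperplane (Suc n) (l :: 'a :: {field, finite})) = CARD('a) ^ n"
proof -
  have "bij_betw (\<lambda>v. v @\<^sub>v vec_of_list [l]) (carrier_vec n) (hyperplane (Suc n) l)"
  proof (rule bij_betwI[where g = "\<lambda>v. vec_first v n"])
    show "(\<lambda>v. v @\<^sub>v vec_of_list [l]) \<in> carrier_vec n \<rightarrow> hyperplane (Suc n) l"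
      by (auto simp: hyperplane_def intro!: carrier_vecI)
    show "(\<lambda>v. vec_first v n) \<in> hyperplane (Suc n) l \<rightarrow> carrier_vec n"
      by auto
    show "vec_first (v @\<^sub>v vec_of_list [l]) n = v" if "v \<in> carrier_vec n" for v
      using that by (auto simp: vec_first_def intro!: eq_vecI)
    show "vec_first v n @\<^sub>v vec_of_list [l] = v" if "v \<in> hyperplane (Suc n) l" for v
      using that by (auto simp: vec_first_def hyperplane_def less_Suc_eq intro!: eq_vecI)
  qed
  from bij_betw_same_card[OF this] show ?thesis
    by (simp add: card_carrier_vec)
qed

text \<open>Since \<open>i\<close> is not the last index, \<open>unit_vec d i\<close> lies in the
  hyperplane. Moving a solution by \<open>t\<close> along it changes the difference of the two inner
  products by \<open>t * (x $ i - y $ i)\<close>, so the q translates of the solution set are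
  disjoint and fit into a hyperplane of size q^(n+1).\<close>

lemma card_orthogonal_in_hyperplane:
  fixes x y :: "'a :: {field, finite} vec"
  assumes x: "x \<in> carrier_vec (Suc (Suc n))" and y: "y \<in> carrier_vec (Suc (Suc n))"
    and i: "i < Suc n" and neq: "x $ i \<noteq> y $ i"
  shows "card {\<theta> \<in> hyperplane (Suc (Suc n)) 0. x \<bullet> \<theta> = y \<bullet> \<theta>} \<le> CARD('a) ^ n"
proof -
  define d where "d = Suc (Suc n)"
  define K where "K = {\<theta> \<in> hyperplane d 0. x \<bullet> \<theta> = y \<bullet> \<theta>}"
  define h where "h = (\<lambda>(\<theta>, t :: 'a). \<theta> + t \<cdot>\<^sub>v unit_vec d i)"
  have xy: "x \<in> carrier_vec d" "y \<in> carrier_vec d" and id: "i < d"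
    using x y i by (auto simp: d_def)
  have K: "\<theta> \<in> carrier_vec d" "x \<bullet> \<theta> = y \<bullet> \<theta>" if "\<theta> \<in> K" for \<theta>
    using that by (auto simp: K_def hyperplane_def)
  have h_prod: "z \<bullet> h (\<theta>, t) = z \<bullet> \<theta> + t * z $ i" if "z \<in> carrier_vec d" "\<theta> \<in> K" for z \<theta> t
    using that K[of \<theta>] id by (simp add: h_def scalar_prod_add_distrib[of _ d])
  have "inj_on h (K \<times> UNIV)"
  proof (rule inj_onI; clarify)
    fix \<theta> t \<theta>' t'
    assume \<theta>: "\<theta> \<in> K" "\<theta>' \<in> K" and eq: "h (\<theta>, t) = h (\<theta>', t')"
    \<comment> \<open>On \<open>K\<close> the two products with \<theta> cancel, so the point
      \<open>h (\<theta>, t)\<close> determines \<open>t\<close>.\<close>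
    have "t * (x $ i - y $ i) = x \<bullet> h (\<theta>, t) - y \<bullet> h (\<theta>, t)"
      using \<theta> xy K by (simp add: h_prod algebra_simps)
    also have "\<dots> = t' * (x $ i - y $ i)"
      unfolding eq using \<theta> xy K by (simp add: h_prod algebra_simps)
    finally have t: "t = t'"
      using neq by simp
    have "\<theta> $ k = \<theta>' $ k" if "k < d" for k
      using arg_cong[OF eq, of "\<lambda>v. v $ k"] that K(1)[OF \<theta>(1)] K(1)[OF \<theta>(2)]
      by (simp add: h_def t)
    then show "\<theta> = \<theta>' \<and> t = t'"
      using t K(1)[OF \<theta>(1)] K(1)[OF \<theta>(2)] by (auto intro!: eq_vecI)
  qed
  moreover have "h ` (K \<times> UNIV) \<subseteq> hyperplane d 0"
    using i by (auto simp: h_def K_def hyperplane_def d_def)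
  moreover have "finite (hyperplane d (0 :: 'a))"
    by (rule finite_subset[OF _ finite_carrier_vec[of d]]) (auto simp: hyperplane_def)
  ultimately have "card (K \<times> (UNIV :: 'a set)) \<le> card (hyperplane d (0 :: 'a))"
    by (metis card_inj_on_le)
  then have "card K * CARD('a) \<le> CARD('a) ^ n * CARD('a)"
    by (simp add: card_cartesian_product d_def card_hyperplane mult.commute)
  then show ?thesis
    by (simp add: K_def d_def)
qed

section \<open>Pairs of points of E with equal inner products\<close>

text \<open>Once the first point is chosen, the second is determined by its last coordinate, which
  ranges over a single fibre of the projection.\<close>

lemma card_pairs_equal_prefix:
  fixes E :: "'a :: {field, finite} vec set"
  assumes E: "E \<subseteq> carrier_vec (Suc n)"
  shows "card {p \<in> E \<times> E. \<forall>i<n. fst p $ i = snd p $ i}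
    \<le> card E * Max (fibre_count E ` carrier_vec n)"
proof -
  have finE: "finite E"
    by (rule finite_subset[OF E finite_carrier_vec])
  have fibre: "card {y \<in> E. \<forall>i<n. x $ i = y $ i} \<le> Max (fibre_count E ` carrier_vec n)" for x
  proof -
    define u where "u = vec_first x n"
    have "{y \<in> E. \<forall>i<n. x $ i = y $ i} \<subseteq> (\<lambda>t. u @\<^sub>v vec_of_list [t]) ` {t. u @\<^sub>v vec_of_list [t] \<in> E}"
    proof
      fix y assume y: "y \<in> {y \<in> E. \<forall>i<n. x $ i = y $ i}"
      then have "y \<in> carrier_vec (Suc n)"
        using E by auto
      with y have "y = u @\<^sub>v vec_of_list [y $ n]"
        by (auto simp: u_def vec_first_def less_Suc_eq intro!: eq_vecI)
      with y show "y \<in> (\<lambda>t. u @\<^sub>v vec_of_list [t]) ` {t. u @\<^sub>v vec_of_list [t] \<in> E}"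
        by (metis (mono_tags, lifting) image_eqI mem_Collect_eq)
    qed
    then have "card {y \<in> E. \<forall>i<n. x $ i = y $ i} \<le> fibre_count E u"
      unfolding fibre_count_def by (rule surj_card_le[rotated]) simp
    also have "\<dots> \<le> Max (fibre_count E ` carrier_vec n)"
      by (rule Max_ge) (auto simp: u_def finite_carrier_vec)
    finally show ?thesis .
  qed
  have "{p \<in> E \<times> E. \<forall>i<n. fst p $ i = snd p $ i} = (SIGMA x:E. {y \<in> E. \<forall>i<n. x $ i = y $ i})"
    by auto
  then have "card {p \<in> E \<times> E. \<forall>i<n. fst p $ i = snd p $ i}
      = (\<Sum>x\<in>E. card {y \<in> E. \<forall>i<n. x $ i = y $ i})"
    using finE by (simp add: card_SigmaI)
  also have "\<dots> \<le> card E * Max (fibre_count E ` carrier_vec n)"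
    using sum_bounded_above[of E, OF fibre] by simp
  finally show ?thesis .
qed

text \<open>After swapping the sums, each pair counts q^n times plus, if its projections agree, an
  excess. Subtracting \<open>(card E)^2 / q\<close> for each direction is tuned to remove the first
  part exactly.\<close>

lemma sum_collisions_le:
  fixes E :: "'a :: {field, finite} vec set"
  assumes E: "E \<subseteq> carrier_vec (Suc (Suc n))"
  defines "q \<equiv> real CARD('a)"
  shows "(\<Sum>\<theta>\<in>hyperplane (Suc (Suc n)) 0.
      real (card {p \<in> E \<times> E. fst p \<bullet> \<theta> = snd p \<bullet> \<theta>}) - (real (card E))\<^sup>2 / q)
    \<le> real (card E) * real (Max (fibre_count E ` carrier_vec (Suc n))) * (q ^ n * (q - 1))"
proof -
  define W where "W = hyperplane (Suc (Suc n)) (0 :: 'a)"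
  define M where "M = Max (fibre_count E ` carrier_vec (Suc n))"
  define D where "D = {p \<in> E \<times> E. \<forall>i<Suc n. fst p $ i = snd p $ i}"
  have finE: "finite E"
    by (rule finite_subset[OF E finite_carrier_vec])
  have cardW: "card W = CARD('a) ^ Suc n"
    unfolding W_def by (rule card_hyperplane)
  then have finW: "finite W"
    by (intro card_ge_0_finite) simp
  have q: "1 \<le> q"
    using finite_UNIV_card_ge_0[where 'a = 'a] by (simp add: q_def Suc_le_eq)
  \<comment> \<open>A pair in \<open>D\<close> may be counted by all q^(n+1) directions; this is
    split as q^n + q^n (q - 1) so that the first term is common to all pairs.\<close>
  have bound: "card {\<theta> \<in> W. fst p \<bullet> \<theta> = snd p \<bullet> \<theta>} \<le>
      CARD('a) ^ n + (if p \<in> D then CARD('a) ^ n * (CARD('a) - 1) else 0)" if "p \<in> E \<times> E" for p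
  proof (cases "p \<in> D")
    case True
    have "card {\<theta> \<in> W. fst p \<bullet> \<theta> = snd p \<bullet> \<theta>} \<le> CARD('a) ^ Suc n"
      unfolding cardW[symmetric] by (rule card_mono) (use finW in auto)
    also have "\<dots> = CARD('a) ^ n + CARD('a) ^ n * (CARD('a) - 1)"
      using q by (simp add: q_def algebra_simps)
    finally show ?thesis
      using True by simp
  next
    case False
    with that obtain i where "i < Suc n" "fst p $ i \<noteq> snd p $ i"
      by (auto simp: D_def)
    moreover have "fst p \<in> carrier_vec (Suc (Suc n))" "snd p \<in> carrier_vec (Suc (Suc n))"
      using that E by auto
    ultimately have "card {\<theta> \<in> W. fst p \<bullet> \<theta> = snd p \<bullet> \<theta>} \<le> CARD('a) ^ n"
      unfolding W_def by (intro card_orthogonal_in_hyperplane)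
    with False show ?thesis
      by simp
  qed
  have "(\<Sum>\<theta>\<in>W. card {p \<in> E \<times> E. fst p \<bullet> \<theta> = snd p \<bullet> \<theta>})
      = (\<Sum>p\<in>E \<times> E. card {\<theta> \<in> W. fst p \<bullet> \<theta> = snd p \<bullet> \<theta>})"
    by (rule sum_card_filter_swap) (use finE finW in auto)
  also have "\<dots> \<le> (\<Sum>p\<in>E \<times> E. CARD('a) ^ n + (if p \<in> D then CARD('a) ^ n * (CARD('a) - 1) else 0))"
    by (rule sum_mono) (rule bound)
  also have "\<dots> = (card E)\<^sup>2 * CARD('a) ^ n + card D * (CARD('a) ^ n * (CARD('a) - 1))"
  proof -
    have "(E \<times> E) \<inter> {p. p \<in> D} = D"
      by (auto simp: D_def)
    then show ?thesis
      using finE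
      by (simp add: sum.distrib sum.If_cases card_cartesian_product power2_eq_square)
  qed
  also have "\<dots> \<le> (card E)\<^sup>2 * CARD('a) ^ n + (card E * M) * (CARD('a) ^ n * (CARD('a) - 1))"
    unfolding D_def M_def by (intro add_left_mono mult_right_mono card_pairs_equal_prefix E) simp
  finally have "real (\<Sum>\<theta>\<in>W. card {p \<in> E \<times> E. fst p \<bullet> \<theta> = snd p \<bullet> \<theta>})
      \<le> real ((card E)\<^sup>2 * CARD('a) ^ n + (card E * M) * (CARD('a) ^ n * (CARD('a) - 1)))"
    by (rule of_nat_mono)
  also have "\<dots> = (real (card E))\<^sup>2 * q ^ n + real (card E) * real M * (q ^ n * (q - 1))"
    using q by (simp add: q_def of_nat_diff)
  \<comment> \<open>The q^(n+1) subtracted terms total \<open>(card E)^2 * q ^ n\<close>, which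
    cancels the common part.\<close>
  finally show ?thesis
    using q by (simp add: sum_subtractf W_def[symmetric] M_def[symmetric] cardW q_def algebra_simps)
qed

section \<open>Coset projections and lines through the origin\<close>

text \<open>The inner product with \<theta> is constant on each coset of the orthogonal complement
  of V. Reading off this constant by \<open>the_elem\<close> maps the cosets meeting E onto the
  values taken on E.\<close>

lemma card_image_le_card_coset_proj:
  fixes E :: "'a :: {field, finite} vec set"
  assumes E: "E \<subseteq> carrier_vec d" and V: "V \<subseteq> carrier_vec d" and \<theta>: "\<theta> \<in> V"
  shows "card ((\<lambda>x. x \<bullet> \<theta>) ` E) \<le> card (coset_proj d V E)"
proof (rule surj_card_le[where f = "\<lambda>C. the_elem ((\<lambda>y. y \<bullet> \<theta>) ` C)", OF finite_coset_proj], rule subsetI)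
  fix s assume "s \<in> (\<lambda>x. x \<bullet> \<theta>) ` E"
  then obtain x where x: "x \<in> E" and s: "s = x \<bullet> \<theta>"
    by blast
  define C where "C = (\<lambda>y. x + y) ` orth_compl d V"
  have zero: "0\<^sub>v d \<in> orth_compl d V"
    using V by (auto simp: orth_compl_def)
  have xd: "x \<in> carrier_vec d"
    using x E by blast
  then have "x \<in> C"
    unfolding C_def by (intro image_eqI[OF _ zero]) simp
  then have "C \<in> coset_proj d V E"
    using x xd by (auto simp: coset_proj_def C_def)
  moreover have "(\<lambda>y. y \<bullet> \<theta>) ` C = {s}"
  proof -
    have "y \<bullet> \<theta> = s" if "y \<in> C" for y
      using that xd V \<theta> by (auto simp: C_def orth_compl_def s add_scalar_prod_distrib[of _ d])
    moreover have "s \<in> (\<lambda>y. y \<bullet> \<theta>) ` C"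
      unfolding s using \<open>x \<in> C\<close> by (rule imageI)
    ultimately show ?thesis
      by blast
  qed
  ultimately show "s \<in> (\<lambda>C. the_elem ((\<lambda>y. y \<bullet> \<theta>) ` C)) ` coset_proj d V E"
    by (metis image_eqI the_elem_eq)
qed

lemma lines_subset_carrier: "V \<in> lines d \<Longrightarrow> V \<subseteq> carrier_vec d"
  by (auto simp: lines_def VectorSpace.subspace_def submodule_def module_vec_simps)

text \<open>A nonzero vector is a linearly independent set whose size is the dimension 1, hence a
  basis.\<close>

lemma line_eq_multiples:
  fixes V :: "'a :: {field, finite} vec set"
  assumes V: "V \<in> lines d" and v: "v \<in> V" "v \<noteq> 0\<^sub>v d"
  shows "V = range (\<lambda>t. t \<cdot>\<^sub>v v)"
proof -
  interpret vec_space "TYPE('a)" d .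
  interpret L: vectorspace class_ring "module_vec TYPE('a) d\<lparr>carrier := V\<rparr>"
    by (rule subspace_is_vs) (use V in \<open>simp add: lines_def\<close>)
  have Vc: "V \<subseteq> carrier_vec d"
    using V by (rule lines_subset_carrier)
  have "finite V"
    by (rule finite_subset[OF Vc finite_carrier_vec])
  \<comment> \<open>The finite set V serves as its own spanning set.\<close>
  then have fd: "L.fin_dim"
    unfolding L.fin_dim_def by (intro exI[of _ V]) (use L.in_own_span[of V] L.span_closed[of V] in auto)
  have dim: "L.dim = 1"
    using V by (simp add: lines_def)
  have "\<not> L.lin_dep {v}"
    using v L.lindep_span[of "{v}"] L.span_empty by (simp add: module_vec_simps)
  then have "L.basis {v}"
    using L.dim_li_is_basis[OF fd, of "{v}"] v dim by simp
  then have "L.span {v} = V"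
    by (simp add: L.basis_def)
  moreover have "L.span {v} = range (\<lambda>t. t \<cdot>\<^sub>v v)"
  proof -
    have "L.lincomb a {v} = a v \<cdot>\<^sub>v v" for a
      using v subsetD[OF Vc v(1)] L.smult_closed[of "a v" v]
      by (simp add: L.lincomb_def L.M.finsum_insert module_vec_simps)
    \<comment> \<open>The multiple by \<open>t\<close> is the linear combination whose coefficient
      function is constantly \<open>t\<close>.\<close>
    then show ?thesis
      using v L.finite_span[of "{v}"] by (auto intro: exI[of _ "\<lambda>_. _"])
  qed
  ultimately show ?thesis
    by simp
qed

lemma card_line_minus_zero:
  fixes V :: "'a :: {field, finite} vec set"
  assumes V: "V \<in> lines d"
  shows "card (V - {0\<^sub>v d}) = CARD('a) - 1"
proof -
  interpret vec_space "TYPE('a)" d .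
  interpret L: vectorspace class_ring "module_vec TYPE('a) d\<lparr>carrier := V\<rparr>"
    by (rule subspace_is_vs) (use V in \<open>simp add: lines_def\<close>)
  have zero: "0\<^sub>v d \<in> V"
    using L.zero_closed by (simp add: module_vec_simps)
  \<comment> \<open>The zero space has dimension 0, so dimension 1 forces a nonzero vector to
    exist.\<close>
  have "V \<noteq> {0\<^sub>v d}"
  proof
    assume "V = {0\<^sub>v d}"
    then have "L.dim = 0"
      by (intro L.dim0I)
        (use L.span_zero[of "{0\<^sub>v d}"] L.span_closed[of "{0\<^sub>v d}"] in \<open>auto simp: module_vec_simps\<close>)
    then show False
      using V by (simp add: lines_def)
  qed
  with zero obtain v where v: "v \<in> V" "v \<noteq> 0\<^sub>v d"
    by blast
  then have "v \<in> carrier_vec d"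
    using lines_subset_carrier[OF V] by blast
  then obtain i where i: "i < d" "v $ i \<noteq> 0"
    using v(2) by (metis carrier_vecD eq_vecI index_zero_vec(1) index_zero_vec(2))
  have "inj (\<lambda>t. t \<cdot>\<^sub>v v)"
  proof (rule injI)
    fix t t' assume "t \<cdot>\<^sub>v v = t' \<cdot>\<^sub>v v"
    from arg_cong[OF this, of "\<lambda>w. w $ i"] show "t = t'"
      using i \<open>v \<in> carrier_vec d\<close> by simp
  qed
  then have "card V = CARD('a)"
    by (subst line_eq_multiples[OF V v]) (rule card_image)
  with zero show ?thesis
    by simp
qed

section \<open>Counting the exceptional lines\<close>

theorem theorem1p5:
  fixes E :: "'a :: {field, finite} vec set" and d q :: nat and N :: real
  assumes "q = CARD('a)" and "odd q"
    and "d \<ge> 3"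
    and "E \<subseteq> carrier_vec d" and "E \<noteq> {}"
    and "0 < N" and "N < real q"
  shows "real (card (exceptional d (lines_meeting d (hyperplane d 0)) E N))
    \<le> 2 * real q ^ (d - 1) * N / ((real q - N) * real (card E))
      * real (Max (fibre_count E ` carrier_vec (d - 1)))"
proof -
  obtain n where d: "d = Suc (Suc n)"
    using \<open>d \<ge> 3\<close> that[of "d - 2"] by simp
  define W where "W = hyperplane d (0 :: 'a)"
  define T where "T = exceptional d (lines_meeting d W) E N"
  define S where "S = (\<Union>V\<in>T. V - {0\<^sub>v d})"
  define M where "M = Max (fibre_count E ` carrier_vec (d - 1))"
  define e where "e = real (card E)"
  define G where "G \<theta> = real (card {p \<in> E \<times> E. fst p \<bullet> \<theta> = snd p \<bullet> \<theta>})" for \<theta>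
  have finE: "finite E"
    by (rule finite_subset[OF \<open>E \<subseteq> carrier_vec d\<close> finite_carrier_vec])
  have e: "0 < e"
    using finE \<open>E \<noteq> {}\<close> by (simp add: e_def card_gt_0_iff)
  have q: "1 < real q"
    using card_mono[of UNIV "{0, 1 :: 'a}"] by (simp add: assms(1))
  have W: "W \<subseteq> carrier_vec d"
    by (auto simp: W_def hyperplane_def)
  have finW: "finite W"
    by (rule finite_subset[OF W finite_carrier_vec])
  have T_lines: "V \<in> lines d" if "V \<in> T" for V
    using that by (simp add: T_def exceptional_def lines_meeting_def)
  \<comment> \<open>As the last coordinate is 0 there, the hyperplane is closed under scaling, so it
    contains every line through one of its nonzero vectors.\<close>
  have T_W: "V \<subseteq> W" if VT: "V \<in> T" for V
  proof -
    obtain v where v: "v \<in> V" "v \<noteq> 0\<^sub>v d" "v \<in> W"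
      using VT by (auto simp: T_def exceptional_def lines_meeting_def)
    then show ?thesis
      using line_eq_multiples[OF T_lines[OF VT] v(1,2)] by (auto simp: W_def hyperplane_def d)
  qed
  have finT: "finite T"
    by (rule finite_subset[OF _ finite_lines[of d]]) (use T_lines in auto)
  have finV: "finite V" if "V \<in> T" for V
    using T_W[OF that] finW by (rule finite_subset)
  have card_line: "card (V - {0\<^sub>v d}) = q - 1" if "V \<in> T" for V
    by (rule card_line_minus_zero[OF T_lines[OF that], folded assms(1)])
  have "card S = (\<Sum>V\<in>T. card (V - {0\<^sub>v d}))"
    unfolding S_def
  proof (rule card_UN_disjoint[OF finT]; intro ballI impI)
    \<comment> \<open>A common nonzero vector would span both lines and make them equal.\<close>
    show "(V - {0\<^sub>v d}) \<inter> (V' - {0\<^sub>v d}) = {}" if "V \<in> T" "V' \<in> T" "V \<noteq> V'" for V V'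
      using that line_eq_multiples[OF T_lines[of V]] line_eq_multiples[OF T_lines[of V']]
      by (metis (no_types, lifting) Diff_iff Int_iff equals0I insertI1)
  qed (simp add: finV)
  then have card_S: "real (card S) = real (card T) * (real q - 1)"
    using q by (simp add: card_line of_nat_diff)
  \<comment> \<open>Used with \<open>c = q\<close>, the number of available values, for every
    direction, and with \<open>c = N\<close> for the exceptional ones.\<close>
  have G_image: "e\<^sup>2 / c \<le> G \<theta>" if "real (card ((\<lambda>x. x \<bullet> \<theta>) ` E)) \<le> c" "0 < c" for \<theta> c
  proof -
    have "e\<^sup>2 \<le> real (card ((\<lambda>x. x \<bullet> \<theta>) ` E)) * G \<theta>"
      unfolding e_def G_def using finE by (rule card_square_le_card_image_times_collisions)
    also have "\<dots> \<le> c * G \<theta>"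
      using that by (intro mult_right_mono) (auto simp: G_def)
    finally show ?thesis
      using that by (simp add: field_simps)
  qed
  have G_ge: "e\<^sup>2 / real q \<le> G \<theta>" for \<theta>
    using q by (intro G_image) (auto simp: assms(1) intro!: card_mono)
  have G_exc: "e\<^sup>2 / N \<le> G \<theta>" if \<theta>S: "\<theta> \<in> S" for \<theta>
  proof (rule G_image[OF _ \<open>0 < N\<close>])
    obtain V where V: "V \<in> T" "\<theta> \<in> V"
      using \<theta>S by (auto simp: S_def)
    have "card ((\<lambda>x. x \<bullet> \<theta>) ` E) \<le> card (coset_proj d V E)"
      by (rule card_image_le_card_coset_proj[OF assms(4) lines_subset_carrier[OF T_lines[OF V(1)]] V(2)])
    moreover have "real (card (coset_proj d V E)) \<le> N"
      using V by (simp add: T_def exceptional_def)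
    ultimately show "real (card ((\<lambda>x. x \<bullet> \<theta>) ` E)) \<le> N"
      by linarith
  qed
  have "real (card T) * (real q - 1) * (e\<^sup>2 / N - e\<^sup>2 / real q) = (\<Sum>\<theta>\<in>S. e\<^sup>2 / N - e\<^sup>2 / real q)"
    by (simp add: card_S)
  also have "\<dots> \<le> (\<Sum>\<theta>\<in>S. G \<theta> - e\<^sup>2 / real q)"
    by (intro sum_mono diff_right_mono G_exc)
  \<comment> \<open>Enlarging \<open>S\<close> to \<open>W\<close> only adds terms that are
    nonnegative by \<open>G_ge\<close>.\<close>
  also have "\<dots> \<le> (\<Sum>\<theta>\<in>W. G \<theta> - e\<^sup>2 / real q)"
    using T_W by (intro sum_mono2 finW) (auto simp: S_def G_ge)
  also have "\<dots> \<le> e * real M * (real q ^ n * (real q - 1))"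
    using sum_collisions_le[of E n] assms(1,4) by (simp add: W_def G_def e_def M_def d)
  also have "e\<^sup>2 / N - e\<^sup>2 / real q = e * (e / N - e / real q)"
    by (simp add: power2_eq_square right_diff_distrib)
  finally have "(real q - 1) * (e * (real (card T) * (e / N - e / real q)))
      \<le> (real q - 1) * (e * (real M * real q ^ n))"
    by (simp only: ac_simps)
  \<comment> \<open>The factor q - 1 cancels: on the left it counts the nonzero vectors of a line,
    on the right it comes from the excess of pairs with equal projections.\<close>
  then have "real (card T) * (e / N - e / real q) \<le> real M * real q ^ n"
    using q e by simp
  also have "e / N - e / real q = (real q - N) * e / (N * real q)"
    using q \<open>0 < N\<close> by (simp add: field_simps)
  \<comment> \<open>The q in the denominator raises q^n to q^(d-1), because d = n + 2.\<close>
  finally have "real (card T) \<le> real q ^ (d - 1) * N / ((real q - N) * e) * real M"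
    using q e \<open>0 < N\<close> \<open>N < real q\<close> by (simp add: field_simps d)
  \<comment> \<open>The factor 2 enters only here, by doubling a nonnegative bound.\<close>
  also have "\<dots> \<le> 2 * real q ^ (d - 1) * N / ((real q - N) * e) * real M"
    using q e \<open>0 < N\<close> \<open>N < real q\<close> by (intro mult_right_mono divide_right_mono) auto
  finally show ?thesis
    by (simp add: T_def W_def M_def e_def)
qed

end
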